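(* Let $\mathsf{Val} : \mathbb{Q}^\omega \to \mathbb{R}$ be a value function. All $\mathsf{Val}$-automata are safe if and only if $\mathsf{Val}$ is safe. Likewise, all $\mathsf{Val}$-automata are co-safe if and only if $\mathsf{Val}$ is co-safe.
   Context: A value function $\mathsf{Val} : \mathbb{Q}^\omega \to \mathbb{R}$ is assumed to be bounded on every finite set of weights: for every finite $V \subset \mathbb{Q}$ there are $m, M \in \mathbb{R}$ with $m \leq \mathsf{Val}(x) \leq M$ for all $x \in V^\omega$. Below, $z \prec x$ means that the finite word $z$ is a strict prefix of $x$ (possibly empty). $\mathsf{Val}$ is safe when for every finite $V \subset \mathbb{Q}$, every $x \in V^\omega$ and $v \in \mathbb{R}$, if $\mathsf{Val}(x) < v$ then there is a finite prefix $z \prec x$ with $\sup_{y \in V^\omega} \mathsf{Val}(zy) < v$. $\mathsf{Val}$ is co-safe when for every finite $V \subset \mathbb{Q}$, every $x \in V^\omega$ and $v \in \mathbb{R}$, if $\mathsf{Val}(x) > v$ then there is a finite prefix $z \prec x$ with $\inf_{y \in V^\omega} \mathsf{Val}(zy) > v$. A (nondeterministic quantitative) automaton is a tuple $\mathcal{A} = (\Sigma, Q, \iota, \delta)$ with a finite alphabet $\Sigma$, a finite nonempty set $Q$ of states, an initial state $\iota \in Q$, and a transition function $\delta : Q \times \Sigma \to 2^{\mathbb{Q} \times Q}$ with finite values; it is required to be total: $\delta(q,\sigma) \neq \emptyset$ for all $q, \sigma$. A run on $w = w[0]w[1]\ldots \in \Sigma^\omega$ is a sequence of transitions $(q_i,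 w[i], x_i, q_{i+1})_{i \geq 0}$ with $q_0 = \iota$ and $(x_i, q_{i+1}) \in \delta(q_i, w[i])$; it yields the weight sequence $x_0 x_1 \ldots$. In a $\mathsf{Val}$-automaton the value of a run is $\mathsf{Val}$ of its weight sequence, and $\mathcal{A}(w)$ is the supremum of the values of all runs of $\mathcal{A}$ on $w$. An automaton $\mathcal{A}$ is safe when for every $w \in \Sigma^\omega$ and $v \in \mathbb{R}$ with $\mathcal{A}(w) < v$ there is $u \prec w$ with $\sup_{w' \in \Sigma^\omega} \mathcal{A}(uw') < v$. It is co-safe when for every $w \in \Sigma^\omega$ and $v \in \mathbb{R}$ with $\mathcal{A}(w) > v$ there is $u \prec w$ with $\inf_{w' \in \Sigma^\omega} \mathcal{A}(uw') > v$. *)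

theory Defs
  imports
    "HOL-Analysis.Analysis"
    "HOL-Library.Stream"
    "HOL-Library.Infinite_Typeclass"
begin

text \<open>
  Infinite words over \<open>V\<close> are the elements of \<^term>\<open>streams V\<close>.
  A finite prefix of an infinite word is always strict, and may be empty.
\<close>

definition prefix_of :: "'a list \<Rightarrow> 'a stream \<Rightarrow> bool"  (infix \<open>\<prec>\<close> 50) where
  "z \<prec> x \<longleftrightarrow> (\<exists>y. x = z @- y)"

definition value_function :: "(rat stream \<Rightarrow> real) \<Rightarrow> bool" where
  "value_function Val \<longleftrightarrow>
    (\<forall>V. finite V \<longrightarrow> (\<exists>m M. \<forall>x\<in>streams V. m \<le> Val x \<and> Val x \<le> M))"

text \<open>
  All suprema and infima below are taken in \<^typ>\<open>real\<close>. For a value function (and an automaton)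
  they range over nonempty bounded sets, so the conventions for \<^const>\<open>Sup\<close> and
  \<^const>\<open>Inf\<close> on other sets play no role.
\<close>

definition safe_value :: "(rat stream \<Rightarrow> real) \<Rightarrow> bool" where
  "safe_value Val \<longleftrightarrow>
    (\<forall>V. finite V \<longrightarrow> (\<forall>x\<in>streams V. \<forall>v. Val x < v \<longrightarrow>
      (\<exists>z. z \<prec> x \<and> (SUP y\<in>streams V. Val (z @- y)) < v)))"

definition cosafe_value :: "(rat stream \<Rightarrow> real) \<Rightarrow> bool" where
  "cosafe_value Val \<longleftrightarrow>
    (\<forall>V. finite V \<longrightarrow> (\<forall>x\<in>streams V. \<forall>v. Val x > v \<longrightarrow>
      (\<exists>z. z \<prec> x \<and> (INF y\<in>streams V. Val (z @- y)) > v)))"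

record ('a, 'q) automaton =
  alphabet :: "'a set"
  states :: "'q set"
  initial :: 'q
  trans :: "'q \<Rightarrow> 'a \<Rightarrow> (rat \<times> 'q) set"

text \<open>
  The values of \<^const>\<open>trans\<close> outside \<open>states A\<close> and \<open>alphabet A\<close> are irrelevant.
\<close>

definition is_automaton :: "('a, 'q) automaton \<Rightarrow> bool" where
  "is_automaton A \<longleftrightarrow>
    finite (alphabet A) \<and> finite (states A) \<and> initial A \<in> states A \<and>
    (\<forall>q\<in>states A. \<forall>a\<in>alphabet A.
      finite (trans A q a) \<and> trans A q a \<noteq> {} \<and> trans A q a \<subseteq> UNIV \<times> states A)"

definition runs ::
    "('a, 'q) automaton \<Rightarrow> 'a stream \<Rightarrow> ('q \<times> 'a \<times> rat \<times> 'q) stream set" where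
  "runs A w =
    {r. fst (r !! 0) = initial A \<and>
        (\<forall>i. case r !! i of (q, a, x, q') \<Rightarrow>
          a = w !! i \<and> (x, q') \<in> trans A q a \<and> fst (r !! Suc i) = q')}"

definition weights :: "('q \<times> 'a \<times> rat \<times> 'q) stream \<Rightarrow> rat stream" where
  "weights = smap (\<lambda>(q, a, x, q'). x)"

definition automaton_value ::
    "(rat stream \<Rightarrow> real) \<Rightarrow> ('a, 'q) automaton \<Rightarrow> 'a stream \<Rightarrow> real" where
  "automaton_value Val A w = (SUP r\<in>runs A w. Val (weights r))"

definition safe_automaton :: "(rat stream \<Rightarrow> real) \<Rightarrow> ('a, 'q) automaton \<Rightarrow> bool" where
  "safe_automaton Val A \<longleftrightarrow>
    (\<forall>w\<in>streams (alphabet A). \<forall>v. automaton_value Val A w < v \<longrightarrow>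
      (\<exists>u. u \<prec> w \<and> (SUP w'\<in>streams (alphabet A). automaton_value Val A (u @- w')) < v))"

definition cosafe_automaton :: "(rat stream \<Rightarrow> real) \<Rightarrow> ('a, 'q) automaton \<Rightarrow> bool" where
  "cosafe_automaton Val A \<longleftrightarrow>
    (\<forall>w\<in>streams (alphabet A). \<forall>v. automaton_value Val A w > v \<longrightarrow>
      (\<exists>u. u \<prec> w \<and> (INF w'\<in>streams (alphabet A). automaton_value Val A (u @- w')) > v))"

text \<open>
  Letters and states are drawn from arbitrary infinite types: every finite alphabet and
  every finite state set embeds into such types, so quantifying over all automata of type
  \<^typ>\<open>('a::infinite, 'q::infinite) automaton\<close> covers all automata up to renaming.
\<close>

end

theory Submission
  imports Defs
begin

text \<open>
  A deterministic one-state automaton that reads its own weights computes \<open>Val\<close>, so the automata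
  over \<open>V\<close> include \<open>Val\<close> itself. Conversely, if \<open>Val\<close> is co-safe, a prefix of a good run witnesses
  co-safety, because totality extends it to a run on every continuation. If \<open>Val\<close> is safe but
  each prefix of \<open>w\<close> had a continuation with a run of value above \<open>c > A(w)\<close>, then by Koenig's lemma
  these runs would accumulate at a run on \<open>w\<close>, whose value is below \<open>c\<close>; safety of \<open>Val\<close>
  bounds the value of all runs that share a long prefix with it, a contradiction.
\<close>

section \<open>Streams\<close>

lemma prefix_of_iff_stake: "z \<prec> x \<longleftrightarrow> z = stake (length z) x"
proof
  assume "z \<prec> x"
  then show "z = stake (length z) x"
    by (auto simp: prefix_of_def stake_shift)
next
  assume "z = stake (length z) x"
  then show "z \<prec> x"
    unfolding prefix_of_def by (metis stake_sdrop)
qed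

lemma stake_eq_snth: "stake n r = stake n s \<Longrightarrow> i < n \<Longrightarrow> r !! i = s !! i"
  by (metis stake_nth)

lemma streams_shift_iff: "z @- y \<in> streams V \<longleftrightarrow> set z \<subseteq> V \<and> y \<in> streams V"
  by (induction z) (auto simp: streams_Stream)

lemma set_stake_streams: "x \<in> streams V \<Longrightarrow> set (stake n x) \<subseteq> V"
  by (metis stake_sdrop streams_shift_iff)

lemma sdrop_in_streams: "x \<in> streams V \<Longrightarrow> sdrop n x \<in> streams V"
  by (metis stake_sdrop streams_shift_iff)

lemma streams_image: "streams (f ` V) = smap f ` streams V"
proof
  show "smap f ` streams V \<subseteq> streams (f ` V)"
    by (auto simp: streams_iff_snth)
  show "streams (f ` V) \<subseteq> smap f ` streams V"
  proof
    fix w assume w: "w \<in> streams (f ` V)"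
    have "w = smap f (smap (inv_into V f) w)"
      unfolding stream.map_comp
      by (rule stream.map_ident_strong[symmetric])
        (use w in \<open>auto simp: streams_iff_sset f_inv_into_f\<close>)
    moreover have "smap (inv_into V f) w \<in> streams V"
      using w by (auto simp: streams_iff_snth inv_into_into)
    ultimately show "w \<in> smap f ` streams V"
      by blast
  qed
qed

text \<open>Koenig's lemma. If infinitely many \<open>r n\<close> start with \<open>l\<close>, then,
  \<open>T\<close> being finite, infinitely many of them start with one and the same extension of
  \<open>l\<close> by a letter; iterating from the empty word spells out \<open>s\<close>.\<close>

lemma stream_sequence_cluster:
  fixes r :: "nat \<Rightarrow> 'b stream"
  assumes "finite T" "\<And>n. r n \<in> streams T"
  obtains s :: "'b stream" where "\<And>k. infinite {n. stake k (r n) = stake k s}"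
proof -
  define I where "I l = {n. stake (length l) (r n) = l}" for l
  \<comment> \<open>The letter picked by \<open>SOME\<close> is meaningful only when
    \<open>I l\<close> is infinite, an invariant that the next fact carries from \<open>l\<close> to
    \<open>step l\<close>.\<close>
  define step where "step l = l @ [SOME t. infinite (I (l @ [t]))]" for l
  have step: "infinite (I (step l))" if "infinite (I l)" for l
  proof -
    have "I l \<subseteq> (\<Union>t\<in>T. I (l @ [t]))"
    proof
      fix n assume "n \<in> I l"
      then have "n \<in> I (l @ [r n !! length l])"
        by (simp add: I_def stake_Suc del: stake.simps)
      then show "n \<in> (\<Union>t\<in>T. I (l @ [t]))"
        using assms(2)[of n] by (auto simp: streams_iff_snth)
    qed
    then have "\<exists>t. infinite (I (l @ [t]))"
      using that assms(1) by (meson finite_UN finite_subset)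
    then show ?thesis
      unfolding step_def by (rule someI_ex)
  qed
  define p where "p k = (step ^^ k) []" for k
  have inf: "infinite (I (p k))" for k
    by (induction k) (auto simp: p_def step, simp add: I_def)
  \<comment> \<open>The words \<open>p k\<close> form a chain of one-letter extensions, so the last
    letters of the nonempty ones spell out their common limit.\<close>
  define s where "s = smap (\<lambda>i. last (p (Suc i))) nats"
  have p: "p (Suc k) = p k @ [last (p (Suc k))]" for k
    by (simp add: p_def step_def)
  have len: "length (p k) = k" for k
    by (induction k) (simp_all add: p_def step_def)
  have "stake k s = p k" for k
  proof (induction k)
    case 0
    then show ?case by (simp add: p_def)
  next
    case (Suc k)
    then show ?case
      using p[of k] by (simp add: stake_Suc s_def del: stake.simps)
  qed
  then show thesis
    using inf len by (intro that[of s]) (auto simp: I_def)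
qed

section \<open>Runs\<close>

text \<open>Safety, co-safety and boundedness of \<open>Val\<close> speak about one finite set of
  weights at a time; for the runs of \<open>A\<close> they are applied to this set.\<close>

definition weight_set :: "('a, 'q) automaton \<Rightarrow> rat set" where
  "weight_set A = (\<Union>q\<in>states A. \<Union>a\<in>alphabet A. fst ` trans A q a)"

lemma finite_weight_set: "is_automaton A \<Longrightarrow> finite (weight_set A)"
  by (auto simp: weight_set_def is_automaton_def)

lemma run_start: "r \<in> runs A w \<Longrightarrow> fst (r !! 0) = initial A"
  by (simp add: runs_def)

lemma run_step:
  assumes "r \<in> runs A w"
  obtains q a x q' where "r !! i = (q, a, x, q')" "a = w !! i" "(x, q') \<in> trans A q a"
    "fst (r !! Suc i) = q'"
proof (cases "r !! i")
  case (fields q a x q')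
  with assms have "a = w !! i \<and> (x, q') \<in> trans A q a \<and> fst (r !! Suc i) = q'"
    by (auto simp: runs_def dest!: spec[of _ i])
  with fields that show ?thesis by blast
qed

lemma trans_state:
  assumes "is_automaton A" "q \<in> states A" "a \<in> alphabet A" "(x, q') \<in> trans A q a"
  shows "q' \<in> states A"
  using assms unfolding is_automaton_def by blast

lemma trans_total:
  assumes "is_automaton A" "q \<in> states A" "a \<in> alphabet A"
  shows "\<exists>x q'. (x, q') \<in> trans A q a"
  using assms unfolding is_automaton_def by (metis ex_in_conv surj_pair)

lemma run_state:
  assumes "is_automaton A" "w \<in> streams (alphabet A)" "r \<in> runs A w"
  shows "fst (r !! i) \<in> states A"
proof (induction i)
  case 0
  then show ?case using assms by (simp add: run_start is_automaton_def del: snth.simps)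
next
  case (Suc i)
  from assms(3) obtain q a x q' where "r !! i = (q, a, x, q')" "a = w !! i"
    "(x, q') \<in> trans A q a" "fst (r !! Suc i) = q'"
    by (rule run_step)
  with Suc trans_state[OF assms(1)] assms(2) show ?case
    by (metis fst_conv streams_iff_snth)
qed

text \<open>Makes runs words over a finite set, so that Koenig's lemma applies to them. Finiteness
  comes from the restriction to \<open>states A\<close> and \<open>alphabet A\<close>, outside of
  which \<open>trans A\<close> is arbitrary.\<close>

definition transitions :: "('a, 'q) automaton \<Rightarrow> ('q \<times> 'a \<times> rat \<times> 'q) set" where
  "transitions A = {(q, a, x, q'). q \<in> states A \<and> a \<in> alphabet A \<and> (x, q') \<in> trans A q a}"

lemma finite_transitions:
  assumes "is_automaton A"
  shows "finite (transitions A)"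
proof (rule finite_subset)
  have "x \<in> weight_set A" if "q \<in> states A" "a \<in> alphabet A" "(x, q') \<in> trans A q a" for q a x q'
    using that unfolding weight_set_def by force
  then show "transitions A \<subseteq> states A \<times> alphabet A \<times> weight_set A \<times> states A"
    using trans_state[OF assms] by (auto simp: transitions_def)
  show "finite (states A \<times> alphabet A \<times> weight_set A \<times> states A)"
    using assms finite_weight_set[OF assms] by (auto simp: is_automaton_def)
qed

lemma run_in_streams:
  assumes "is_automaton A" "w \<in> streams (alphabet A)" "r \<in> runs A w"
  shows "r \<in> streams (transitions A)"
  unfolding streams_iff_snth
proof
  fix i
  from assms(3) show "r !! i \<in> transitions A"
    by (rule run_step[where i = i])
      (use run_state[OF assms, of i] assms(2) in \<open>auto simp: transitions_def streams_iff_snth\<close>)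
qed

lemma weights_in_streams:
  assumes "is_automaton A" "w \<in> streams (alphabet A)" "r \<in> runs A w"
  shows "weights r \<in> streams (weight_set A)"
proof -
  have "(\<lambda>(q, a, x, q'). x) ` transitions A \<subseteq> weight_set A"
    by (force simp: transitions_def weight_set_def)
  then show ?thesis
    using run_in_streams[OF assms] unfolding weights_def
    by (meson smap_streams image_subset_iff)
qed

text \<open>Totality lets a run be built one transition at a time by dependent choice. This makes
  the supremum in \<open>automaton_value\<close> one over a nonempty set, and it later allows a
  finite run to be prolonged on any continuation.\<close>

lemma runs_nonempty:
  assumes A: "is_automaton A" and w: "w \<in> streams (alphabet A)"
  shows "runs A w \<noteq> {}"
proof -
  have total: "\<exists>x q'. (x, q') \<in> trans A q (w !! n)" if "q \<in> states A" for q n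
    using trans_total[OF A that] w by (simp add: streams_iff_snth)
  \<comment> \<open>Dependent choice only relates consecutive transitions, so the starting state is
    imposed through the clause for \<open>n = 0\<close>.\<close>
  define P where "P n t \<longleftrightarrow> (\<exists>q x q'. t = (q, w !! n, x, q') \<and> q \<in> states A \<and>
    (x, q') \<in> trans A q (w !! n) \<and> (n = 0 \<longrightarrow> q = initial A))" for n t
  have "\<exists>f. \<forall>n. P n (f n) \<and> fst (f (Suc n)) = snd (snd (snd (f n)))"
  proof (rule dependent_nat_choice)
    have "initial A \<in> states A"
      using A by (simp add: is_automaton_def)
    then show "\<exists>t. P 0 t"
      using total unfolding P_def by blast
    fix t n assume "P n t"
    then obtain q x q' where "t = (q, w !! n, x, q')" "q \<in> states A" "(x, q') \<in> trans A q (w !! n)"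
      unfolding P_def by blast
    moreover from this have "q' \<in> states A"
      using trans_state[OF A] w by (metis streams_iff_snth)
    moreover from this obtain y q'' where "(y, q'') \<in> trans A q' (w !! Suc n)"
      using total by blast
    ultimately show "\<exists>t'. P (Suc n) t' \<and> fst t' = snd (snd (snd t))"
      unfolding P_def by (intro exI[of _ "(q', w !! Suc n, y, q'')"]) (simp del: snth.simps)
  qed
  then obtain f where f: "\<And>n. P n (f n)" "\<And>n. fst (f (Suc n)) = snd (snd (snd (f n)))"
    by blast
  have "case f i of (q, a, x, q') \<Rightarrow>
      a = w !! i \<and> (x, q') \<in> trans A q a \<and> fst (f (Suc i)) = q'" for i
    using f(1)[of i] f(2)[of i] unfolding P_def by auto
  moreover have "fst (f 0) = initial A"
    using f(1)[of 0] unfolding P_def by auto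
  ultimately have "smap f nats \<in> runs A w"
    by (simp add: runs_def del: snth.simps)
  then show ?thesis by blast
qed

text \<open>Restarted in the state that \<open>r\<close> reaches after \<open>n\<close> transitions,
  the automaton is still total and hence has a run \<open>s\<close> on \<open>w'\<close>; the two
  pieces meet in that state and can be glued.\<close>

lemma run_extend:
  assumes A: "is_automaton A" and w: "w \<in> streams (alphabet A)" and r: "r \<in> runs A w"
    and w': "w' \<in> streams (alphabet A)"
  obtains s where "stake n r @- s \<in> runs A (stake n w @- w')"
proof -
  let ?B = "A\<lparr>initial := fst (r !! n)\<rparr>"
  have B: "is_automaton ?B"
    using A run_state[OF A w r] by (simp add: is_automaton_def)
  from runs_nonempty[OF B] w' obtain s where s: "s \<in> runs ?B w'" by auto
  \<comment> \<open>The range includes the seam \<open>i = n\<close>, where \<open>s\<close> starts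
    in the initial state of \<open>?B\<close>, that is, in the state reached by
    \<open>r\<close>.\<close>
  have fst_eq: "fst ((stake n r @- s) !! i) = fst (r !! i)" if "i \<le> n" for i
    using that run_start[OF s]
    by (cases "i < n") (auto simp: shift_snth_less shift_snth_ge)
  have "case (stake n r @- s) !! i of (q, a, x, q') \<Rightarrow>
      a = (stake n w @- w') !! i \<and> (x, q') \<in> trans A q a \<and>
      fst ((stake n r @- s) !! Suc i) = q'" for i
  proof (cases "i < n")
    case True
    from r show ?thesis
      by (rule run_step[where i = i])
        (use True fst_eq[of "Suc i"] in \<open>auto simp: shift_snth_less simp del: snth.simps\<close>)
  next
    case False
    from s show ?thesis
      by (rule run_step[where i = "i - n"])
        (use False in \<open>auto simp: shift_snth_ge Suc_diff_le simp del: snth.simps\<close>)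
  qed
  then have "stake n r @- s \<in> runs A (stake n w @- w')"
    using fst_eq[of 0] run_start[OF r] by (simp add: runs_def del: snth.simps)
  then show thesis by (rule that)
qed

text \<open>Apart from the initial state, being a run is a condition on pairs of consecutive
  transitions, so a cluster point of the \<open>r n\<close> inherits it. It reads \<open>w\<close>
  because the words read by the \<open>r n\<close> agree with \<open>w\<close> on ever longer
  prefixes.\<close>

lemma run_limit:
  assumes A: "is_automaton A"
    and w: "\<And>n. w' n \<in> streams (alphabet A)" "w \<in> streams (alphabet A)"
    and r: "\<And>n. r n \<in> runs A (stake n w @- w' n)"
  obtains s where "s \<in> runs A w" "\<And>k. \<exists>n\<ge>k. stake k (r n) = stake k s"
proof -
  have "stake n w @- w' n \<in> streams (alphabet A)" for n
    using w by (simp add: streams_shift_iff set_stake_streams)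
  from run_in_streams[OF A this r] stream_sequence_cluster[OF finite_transitions[OF A]]
  obtain s where "\<And>k. infinite {n. stake k (r n) = stake k s}" by metis
  then have s: "\<exists>n\<ge>k. stake k (r n) = stake k s" for k
    unfolding infinite_nat_iff_unbounded_le by blast
  have "fst (s !! 0) = initial A"
    using s[of 1] r by (metis run_start stake_eq_snth zero_less_one)
  moreover have "case s !! i of (q, a, x, q') \<Rightarrow>
      a = w !! i \<and> (x, q') \<in> trans A q a \<and> fst (s !! Suc i) = q'" for i
  proof -
    \<comment> \<open>Length \<open>i + 2\<close> covers the positions \<open>i\<close> and
      \<open>Suc i\<close>, while \<open>n \<ge> i + 2\<close> puts position \<open>i\<close> inside
      the part of \<open>w\<close> that \<open>r n\<close> reads.\<close>
    obtain n where n: "n \<ge> i + 2" "stake (i + 2) (r n) = stake (i + 2) s"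
      using s by blast
    then have eq: "r n !! i = s !! i" "r n !! Suc i = s !! Suc i"
      using stake_eq_snth[OF n(2), of i] stake_eq_snth[OF n(2), of "Suc i"]
      by (simp_all del: snth.simps)
    show ?thesis
      by (rule run_step[OF r[of n], where i = i])
        (use n(1) eq in \<open>auto simp: shift_snth_less simp del: snth.simps\<close>)
  qed
  ultimately have "s \<in> runs A w" by (simp add: runs_def)
  with s that show thesis by blast
qed

section \<open>Values\<close>

lemma value_function_bdd:
  assumes "value_function Val" "finite V"
  shows "bdd_above (Val ` streams V)" "bdd_below (Val ` streams V)"
proof -
  obtain m M where "\<forall>x\<in>streams V. m \<le> Val x \<and> Val x \<le> M"
    using assms unfolding value_function_def by meson
  then show "bdd_above (Val ` streams V)" "bdd_below (Val ` streams V)"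
    by (auto intro: bdd_aboveI2 bdd_belowI2)
qed

text \<open>Only finitely many weights occur in \<open>A\<close>, so boundedness of
  \<open>Val\<close> makes the real supremum a genuine upper bound.\<close>

lemma run_value_le:
  assumes "value_function Val" "is_automaton A" "w \<in> streams (alphabet A)" "r \<in> runs A w"
  shows "Val (weights r) \<le> automaton_value Val A w"
proof -
  have "(\<lambda>r. Val (weights r)) ` runs A w \<subseteq> Val ` streams (weight_set A)"
    using weights_in_streams[OF assms(2,3)] by auto
  then have "bdd_above ((\<lambda>r. Val (weights r)) ` runs A w)"
    using value_function_bdd(1)[OF assms(1) finite_weight_set[OF assms(2)]]
    by (rule bdd_above_mono[rotated])
  then show ?thesis
    unfolding automaton_value_def using assms(4) by (rule cSUP_upper[rotated])
qed

lemma weights_stake: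
  assumes "stake k r = stake k s"
  shows "stake k (weights r) = stake k (weights s)"
  using assms by (simp add: weights_def stake_smap)

section \<open>From the value function to its automata\<close>

text \<open>Compactness enters because, under nondeterminism, the runs of high value after different
  prefixes of \<open>w\<close> may be unrelated; their cluster point supplies one run on
  \<open>w\<close> to which safety of \<open>Val\<close> can be applied.\<close>

lemma safe_value_imp_safe_automaton:
  assumes Val: "value_function Val" and safe: "safe_value Val" and A: "is_automaton A"
  shows "safe_automaton Val A"
  unfolding safe_automaton_def
proof (intro ballI allI impI, rule ccontr)
  fix w v
  assume w: "w \<in> streams (alphabet A)" and less: "automaton_value Val A w < v"
    and no: "\<not> (\<exists>u. u \<prec> w \<and> (SUP w'\<in>streams (alphabet A). automaton_value Val A (u @- w')) < v)"
  \<comment> \<open>Failure of safety only yields suprema of at least \<open>v\<close>. The gap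
    between \<open>c\<close> and \<open>v\<close> turns this into an actual run of value above
    \<open>c\<close> after every prefix.\<close>
  obtain c where c: "automaton_value Val A w < c" "c < v"
    using dense[OF less] by blast
  have in_streams: "stake n w @- w' \<in> streams (alphabet A)" if "w' \<in> streams (alphabet A)" for n w'
    using that w by (simp add: streams_shift_iff set_stake_streams)
  have "\<exists>w' r. w' \<in> streams (alphabet A) \<and> r \<in> runs A (stake n w @- w') \<and> c < Val (weights r)"
    for n
  proof (rule ccontr)
    assume "\<not> ?thesis"
    then have "automaton_value Val A (stake n w @- w') \<le> c" if "w' \<in> streams (alphabet A)" for w'
      unfolding automaton_value_def using that runs_nonempty[OF A in_streams[OF that]]
      by (intro cSUP_least) (auto simp: not_less)
    then have "(SUP w'\<in>streams (alphabet A). automaton_value Val A (stake n w @- w')) \<le> c"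
      using w by (intro cSUP_least) auto
    moreover have "stake n w \<prec> w"
      unfolding prefix_of_def by (metis stake_sdrop)
    ultimately show False
      using no c by (meson le_less_trans)
  qed
  then obtain w' r where r: "\<And>n. w' n \<in> streams (alphabet A)"
      "\<And>n. r n \<in> runs A (stake n w @- w' n)" "\<And>n. c < Val (weights (r n))"
    by metis
  obtain s where s: "s \<in> runs A w" "\<And>k. \<exists>n\<ge>k. stake k (r n) = stake k s"
    using run_limit[OF A r(1) w r(2)] by blast
  \<comment> \<open>The limit reads \<open>w\<close> itself, so its value stays below
    \<open>c\<close>, whereas all the runs \<open>r n\<close> lie above \<open>c\<close>.\<close>
  have "Val (weights s) < c"
    using run_value_le[OF Val A w s(1)] c by simp
  then obtain z where z: "z \<prec> weights s" "(SUP y\<in>streams (weight_set A). Val (z @- y)) < c"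
    using safe finite_weight_set[OF A] weights_in_streams[OF A w s(1)]
    unfolding safe_value_def by blast
  obtain n where "stake (length z) (r n) = stake (length z) s"
    using s(2) by blast
  \<comment> \<open>The first \<open>length z\<close> weights of \<open>r n\<close> are those of
    \<open>s\<close>, so the value of \<open>r n\<close> is among those that safety bounds after
    \<open>z\<close>.\<close>
  then have eq: "weights (r n) = z @- sdrop (length z) (weights (r n))"
    using z(1) by (metis prefix_of_iff_stake stake_sdrop weights_stake)
  have n: "weights (r n) \<in> streams (weight_set A)"
    using weights_in_streams[OF A in_streams[OF r(1)] r(2)] .
  then have "set z \<subseteq> weight_set A"
    by (metis eq streams_shift_iff)
  then have "(\<lambda>y. Val (z @- y)) ` streams (weight_set A) \<subseteq> Val ` streams (weight_set A)"
    by (auto simp: streams_shift_iff)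
  then have "bdd_above ((\<lambda>y. Val (z @- y)) ` streams (weight_set A))"
    using value_function_bdd(1)[OF Val finite_weight_set[OF A]] by (rule bdd_above_mono[rotated])
  from cSUP_upper[OF sdrop_in_streams[OF n, of "length z"] this] eq
  have "Val (weights (r n)) \<le> (SUP y\<in>streams (weight_set A). Val (z @- y))"
    by simp
  with z(2) r(3)[of n] show False by simp
qed

text \<open>A supremum above \<open>v\<close> is exceeded by a single run \<open>r\<close>, and some
  prefix \<open>z\<close> of its weights already guarantees more than \<open>v\<close>. The prefix
  of \<open>w\<close> of the same length is a witness, since that part of \<open>r\<close> extends
  to a run on each continuation.\<close>

lemma cosafe_value_imp_cosafe_automaton:
  assumes Val: "value_function Val" and cosafe: "cosafe_value Val" and A: "is_automaton A"
  shows "cosafe_automaton Val A"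
  unfolding cosafe_automaton_def
proof (intro ballI allI impI)
  fix w v
  assume w: "w \<in> streams (alphabet A)" and "v < automaton_value Val A w"
  then obtain r where r: "r \<in> runs A w" "v < Val (weights r)"
    unfolding automaton_value_def
    using runs_nonempty[OF A w] by (meson cSUP_least not_less)
  then obtain z where z: "z \<prec> weights r" "v < (INF y\<in>streams (weight_set A). Val (z @- y))"
    using cosafe finite_weight_set[OF A] weights_in_streams[OF A w]
    unfolding cosafe_value_def by blast
  let ?n = "length z" and ?c = "INF y\<in>streams (weight_set A). Val (z @- y)"
  have z_eq: "z = stake ?n (weights r)"
    using z(1) by (simp add: prefix_of_iff_stake)
  then have "set z \<subseteq> weight_set A"
    using weights_in_streams[OF A w r(1)] by (metis set_stake_streams)
  then have "(\<lambda>y. Val (z @- y)) ` streams (weight_set A) \<subseteq> Val ` streams (weight_set A)"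
    by (auto simp: streams_shift_iff)
  then have bdd: "bdd_below ((\<lambda>y. Val (z @- y)) ` streams (weight_set A))"
    using value_function_bdd(2)[OF Val finite_weight_set[OF A]] by (rule bdd_below_mono[rotated])
  \<comment> \<open>The bound \<open>?c\<close> is uniform in \<open>w'\<close> and strictly above
    \<open>v\<close>; values that merely exceed \<open>v\<close> for each \<open>w'\<close> could
    still have infimum \<open>v\<close>.\<close>
  have "?c \<le> automaton_value Val A (stake ?n w @- w')" if w': "w' \<in> streams (alphabet A)" for w'
  proof -
    obtain s where s: "stake ?n r @- s \<in> runs A (stake ?n w @- w')"
      using run_extend[OF A w r(1) w'] .
    have uw: "stake ?n w @- w' \<in> streams (alphabet A)"
      using w w' by (simp add: streams_shift_iff set_stake_streams)
    have eq: "weights (stake ?n r @- s) = z @- weights s"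
      using z_eq by (simp add: weights_def stake_smap)
    then have "weights s \<in> streams (weight_set A)"
      using weights_in_streams[OF A uw s] by (simp add: streams_shift_iff)
    with bdd have "?c \<le> Val (z @- weights s)"
      by (rule cINF_lower)
    also have "\<dots> \<le> automaton_value Val A (stake ?n w @- w')"
      using run_value_le[OF Val A uw s] eq by simp
    finally show ?thesis .
  qed
  then have "?c \<le> (INF w'\<in>streams (alphabet A). automaton_value Val A (stake ?n w @- w'))"
    using w by (intro cINF_greatest) auto
  moreover have "stake ?n w \<prec> w"
    unfolding prefix_of_def by (metis stake_sdrop)
  ultimately show "\<exists>u. u \<prec> w \<and> v < (INF w'\<in>streams (alphabet A). automaton_value Val A (u @- w'))"
    using z(2) less_le_trans by blast
qed

section \<open>From automata back to the value function\<close>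

text \<open>The letter type is arbitrary, so weights are renamed by an injection \<open>g\<close>
  into it. The single state loops on the letter \<open>g v\<close> with weight \<open>v\<close>; the
  only run on a renamed word undoes the renaming.\<close>

lemma value_automaton:
  fixes V :: "rat set"
  assumes "finite V"
  obtains A :: "('a::infinite, 'q::infinite) automaton" and g
  where "is_automaton A" "alphabet A = g ` V"
    "\<And>Val x. x \<in> streams V \<Longrightarrow> automaton_value Val A (smap g x) = Val x"
proof -
  \<comment> \<open>An infinite type contains finite sets of every size, in particular a copy of
    \<open>V\<close>.\<close>
  obtain B :: "'a set" where "finite B" "card B = card V"
    using infinite_arbitrarily_large[OF infinite_UNIV] by metis
  then obtain g where "bij_betw g V B"
    using assms finite_same_card_bij by metis
  then have g: "inj_on g V" by (simp add: bij_betw_def)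
  define q where "q = (undefined :: 'q)"
  let ?A = "\<lparr>alphabet = g ` V, states = {q}, initial = q,
    trans = \<lambda>_ a. {(inv_into V g a, q)}\<rparr>"
  have automaton: "is_automaton ?A"
    using assms by (simp add: is_automaton_def)
  have "automaton_value Val ?A (smap g x) = Val x" if x: "x \<in> streams V" for Val x
  proof -
    \<comment> \<open>By determinism the supremum in \<open>automaton_value\<close> is over one run,
      whose weights are \<open>x\<close>.\<close>
    have "runs ?A (smap g x) = {smap (\<lambda>v. (q, g v, v, q)) x}" (is "?R = {?r}")
    proof (intro equalityI subsetI)
      fix r assume r: "r \<in> ?R"
      have "r !! i = ?r !! i" for i
      proof -
        have "fst (r !! i) = q" "fst (r !! Suc i) = q"
          using run_state[OF automaton _ r] x by (auto simp: streams_image simp del: snth.simps)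
        moreover obtain p a v p' where "r !! i = (p, a, v, p')" "a = smap g x !! i"
          "(v, p') \<in> {(inv_into V g a, q)}" "fst (r !! Suc i) = p'"
          by (rule run_step[OF r, of i]) simp
        ultimately show ?thesis
          using x g by (simp add: streams_iff_snth del: snth.simps)
      qed
      then have "?r = r"
        unfolding smap_alt by simp
      then show "r \<in> {?r}" by simp
    next
      fix r assume "r \<in> {?r}"
      then show "r \<in> ?R"
        using x g by (auto simp: runs_def streams_iff_snth simp del: snth.simps)
    qed
    then show ?thesis
      by (simp add: automaton_value_def weights_def stream.map_comp comp_def stream.map_ident)
  qed
  with automaton show thesis
    by (intro that[of ?A g]) simp_all
qed

text \<open>Prefixes and continuations of renamed words are themselves renamings of words over
  \<open>V\<close>. Equality of the two sets of values serves suprema and infima alike.\<close>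

lemma value_automaton_continuations:
  assumes g: "alphabet A = g ` V"
    and val: "\<And>x. x \<in> streams V \<Longrightarrow> automaton_value Val A (smap g x) = Val x"
    and x: "x \<in> streams V" and u: "u \<prec> smap g x"
  obtains z where "prefix_of z x"
    "(\<lambda>w'. automaton_value Val A (u @- w')) ` streams (alphabet A) =
     (\<lambda>y. Val (z @- y)) ` streams V"
proof -
  let ?z = "stake (length u) x"
  have u_eq: "u = map g ?z"
    using u by (simp add: prefix_of_iff_stake stake_smap)
  have "automaton_value Val A (u @- smap g y) = Val (?z @- y)" if "y \<in> streams V" for y
  proof -
    have "?z @- y \<in> streams V"
      using that x by (simp add: streams_shift_iff set_stake_streams)
    from val[OF this] show ?thesis
      using u_eq by simp
  qed
  then have "(\<lambda>w'. automaton_value Val A (u @- w')) ` streams (alphabet A) =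
     (\<lambda>y. Val (?z @- y)) ` streams V"
    by (simp add: g streams_image image_image)
  moreover have "?z \<prec> x"
    unfolding prefix_of_def by (metis stake_sdrop)
  ultimately show thesis by (rule that[rotated])
qed

text \<open>The one-state automaton over a copy of \<open>V\<close> is safe, and a prefix witnessing
  this at \<open>smap g x\<close> pulls back to a prefix of \<open>x\<close> with the same
  supremum.\<close>

lemma safe_value_if_safe_automata:
  assumes "\<forall>A :: ('a::infinite, 'q::infinite) automaton. is_automaton A \<longrightarrow> safe_automaton Val A"
  shows "safe_value Val"
  unfolding safe_value_def
proof (intro allI impI ballI)
  fix V x v
  assume V: "finite V" and x: "x \<in> streams V" and less: "Val x < v"
  obtain A :: "('a, 'q) automaton" and g where A: "is_automaton A" and g: "alphabet A = g ` V"
    and val: "\<And>x. x \<in> streams V \<Longrightarrow> automaton_value Val A (smap g x) = Val x"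
    using value_automaton[OF V] by metis
  have "smap g x \<in> streams (alphabet A)"
    using x by (simp add: g streams_image)
  with assms A less val[OF x] obtain u where u: "u \<prec> smap g x"
      "(SUP w'\<in>streams (alphabet A). automaton_value Val A (u @- w')) < v"
    unfolding safe_automaton_def by metis
  from value_automaton_continuations[OF g val x u(1)] u(2)
  show "\<exists>z. z \<prec> x \<and> (SUP y\<in>streams V. Val (z @- y)) < v"
    by metis
qed

lemma cosafe_value_if_cosafe_automata:
  assumes "\<forall>A :: ('a::infinite, 'q::infinite) automaton. is_automaton A \<longrightarrow> cosafe_automaton Val A"
  shows "cosafe_value Val"
  unfolding cosafe_value_def
proof (intro allI impI ballI)
  fix V x v
  assume V: "finite V" and x: "x \<in> streams V" and less: "v < Val x"
  obtain A :: "('a, 'q) automaton" and g where A: "is_automaton A" and g: "alphabet A = g ` V"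
    and val: "\<And>x. x \<in> streams V \<Longrightarrow> automaton_value Val A (smap g x) = Val x"
    using value_automaton[OF V] by metis
  have "smap g x \<in> streams (alphabet A)"
    using x by (simp add: g streams_image)
  with assms A less val[OF x] obtain u where u: "u \<prec> smap g x"
      "v < (INF w'\<in>streams (alphabet A). automaton_value Val A (u @- w'))"
    unfolding cosafe_automaton_def by metis
  from value_automaton_continuations[OF g val x u(1)] u(2)
  show "\<exists>z. z \<prec> x \<and> v < (INF y\<in>streams V. Val (z @- y))"
    by metis
qed

theorem theorem8p3:
  fixes Val :: "rat stream \<Rightarrow> real"
  assumes "value_function Val"
  shows "((\<forall>A :: ('a::infinite, 'q::infinite) automaton.
             is_automaton A \<longrightarrow> safe_automaton Val A) \<longleftrightarrow> safe_value Val) \<and>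
         ((\<forall>A :: ('a, 'q) automaton.
             is_automaton A \<longrightarrow> cosafe_automaton Val A) \<longleftrightarrow> cosafe_value Val)"
  using safe_value_imp_safe_automaton[OF assms] cosafe_value_imp_cosafe_automaton[OF assms]
    safe_value_if_safe_automata cosafe_value_if_cosafe_automata
  by metis

end
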